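(* For each positive integer $k$, the asymptotic density $\mathbf{d}(\mathscr{A}_k)$ of the set $\mathscr{A}_k = \{n \geq 1 : \gcd(n, F_n) = k\}$ exists. Moreover, the following three conditions are equivalent: $\mathbf{d}(\mathscr{A}_k) > 0$; $\mathscr{A}_k \neq \varnothing$; $k = \gcd(\ell(k), F_{\ell(k)})$.
   Context: $(F_n)_{n \geq 1}$ is the sequence of Fibonacci numbers: $F_1 = F_2 = 1$ and $F_{n+2} = F_{n+1} + F_n$ for all integers $n \geq 1$. For a positive integer $m$, $z(m)$ (the rank of appearance) denotes the smallest positive integer $n$ such that $m$ divides $F_n$ (it always exists), and $\ell(m) := \operatorname{lcm}(m, z(m))$. For a set $\mathscr{S}$ of positive integers, its asymptotic density $\mathbf{d}(\mathscr{S})$ is the limit of $\#(\mathscr{S} \cap [1,x])/x$ as $x \to +\infty$, whenever this limit exists. *)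

theory Defs
  imports Complex_Main "HOL-Number_Theory.Fib"
begin

text \<open>
  The Fibonacci sequence is the library's \<^term>\<open>fib\<close>, which agrees with the usual
  convention \<open>F\<^sub>1 = F\<^sub>2 = 1\<close> and is extended by \<open>F\<^sub>0 = 0\<close>.
  Positivity is therefore required explicitly wherever an index ranges over the positive integers.
\<close>

text \<open>Every positive \<open>m\<close> divides some \<open>F\<^sub>n\<close> with \<open>n > 0\<close>, so the minimum below is attained.\<close>

definition rank_of_appearance :: "nat \<Rightarrow> nat" where
  "rank_of_appearance m = (LEAST n. n > 0 \<and> m dvd fib n)"

definition ell :: "nat \<Rightarrow> nat" where
  "ell m = lcm m (rank_of_appearance m)"

definition has_asymptotic_density :: "nat set \<Rightarrow> real \<Rightarrow> bool" where
  "has_asymptotic_density S d \<longleftrightarrow>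
     ((\<lambda>x::real. real (card {n \<in> S. 1 \<le> n \<and> real n \<le> x}) / x) \<longlongrightarrow> d) at_top"

text \<open>The following value is meaningful only for sets that have an asymptotic density.\<close>

definition asymptotic_density :: "nat set \<Rightarrow> real" where
  "asymptotic_density S = (THE d. has_asymptotic_density S d)"

lemma asymptotic_density_eqI:
  assumes "has_asymptotic_density S d"
  shows "asymptotic_density S = d"
  using assms tendsto_unique[OF trivial_limit_at_top_linorder]
  unfolding asymptotic_density_def has_asymptotic_density_def by blast

definition gcd_fib_set :: "nat \<Rightarrow> nat set" where
  "gcd_fib_set k = {n. n \<ge> 1 \<and> gcd n (fib n) = k}"

end

theory Submission
  imports Defs "HOL-Analysis.Analysis" "HOL-Number_Theory.Residues"
begin

text \<open>
  Since \<open>m\<close> divides \<open>gcd(n, F\<^sub>n)\<close> exactly when \<open>\<ell>(m)\<close> divides \<open>n\<close>, the set \<open>A\<^sub>k\<close> consists of the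
  \<open>n = \<ell>(k) m\<close> such that \<open>m\<close> avoids all multiples of the integers \<open>\<ell>(k p) / \<ell>(k)\<close>, \<open>p\<close> prime.
  Avoiding the multiples of a set with convergent reciprocal sum defines a set that has a density,
  and by the inequality of Heilbronn and Rohrbach this density is positive unless \<open>1\<close> is in the set.
  It remains to see that \<open>\<Sum> 1 / \<ell>(p)\<close> converges. For \<open>p \<noteq> 2, 5\<close> one has \<open>\<ell>(p) = p z(p)\<close>, and
  there are at most \<open>m\<close> primes with \<open>z(p) = m\<close>, their product being a divisor of
  \<open>F\<^sub>m \<le> 2\<^sup>m\<close>; hence \<open>1 / (p z(p)) \<le> p\<^sup>-\<^sup>5\<^sup>/\<^sup>3 + z(p)\<^sup>-\<^sup>5\<^sup>/\<^sup>2\<close> is summable.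
\<close>

section \<open>Density of sets of nonmultiples\<close>

definition counting :: "nat set \<Rightarrow> real \<Rightarrow> nat" where
  "counting S x = card {n \<in> S. 1 \<le> n \<and> real n \<le> x}"

lemma has_asymptotic_density_counting:
  "has_asymptotic_density S d \<longleftrightarrow> ((\<lambda>x. real (counting S x) / x) \<longlongrightarrow> d) at_top"
  by (simp add: has_asymptotic_density_def counting_def)

lemma finite_counted: "finite {n \<in> S. 1 \<le> n \<and> real n \<le> x}"
proof (rule finite_subset)
  show "{n \<in> S. 1 \<le> n \<and> real n \<le> x} \<subseteq> {..nat \<lfloor>x\<rfloor>}"
    by (auto simp: le_nat_floor)
qed simp

lemma counting_mono: "S \<subseteq> T \<Longrightarrow> counting S x \<le> counting T x"
  unfolding counting_def by (rule card_mono[OF finite_counted]) auto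

lemma counting_Diff:
  assumes "R \<subseteq> S"
  shows "real (counting (S - R) x) = real (counting S x) - real (counting R x)"
proof -
  have "counting (S - R) x
      = card ({n \<in> S. 1 \<le> n \<and> real n \<le> x} - {n \<in> R. 1 \<le> n \<and> real n \<le> x})"
    unfolding counting_def by (rule arg_cong[where f = card]) auto
  also have "\<dots> = counting S x - counting R x"
    unfolding counting_def using assms finite_counted by (intro card_Diff_subset) auto
  finally show ?thesis
    using counting_mono[OF assms] by (simp add: of_nat_diff)
qed

lemma counting_scale:
  assumes "a > 0"
  shows "counting ((*) a ` S) x = counting S (x / real a)"
proof -
  have "{n \<in> (*) a ` S. 1 \<le> n \<and> real n \<le> x} = (*) a ` {n \<in> S. 1 \<le> n \<and> real n \<le> x / real a}"
    using assms by (auto simp: field_simps)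
  moreover have "inj_on ((*) a) T" for T :: "nat set"
    using assms by (auto intro: inj_onI)
  ultimately show ?thesis
    by (simp add: counting_def card_image)
qed

lemma counting_UNIV: "counting UNIV x = nat \<lfloor>x\<rfloor>"
proof -
  have "1 \<le> n \<and> real n \<le> x \<longleftrightarrow> 1 \<le> n \<and> n \<le> nat \<lfloor>x\<rfloor>" for n :: nat
    by linarith
  then have "{n::nat. 1 \<le> n \<and> real n \<le> x} = {1..nat \<lfloor>x\<rfloor>}"
    by (simp only: set_eq_iff mem_Collect_eq atLeastAtMost_iff simp_thms)
  then show ?thesis by (simp add: counting_def)
qed

lemma has_asymptotic_density_UNIV: "has_asymptotic_density UNIV 1"
proof -
  have "((\<lambda>x. real (nat \<lfloor>x\<rfloor>) / x) \<longlongrightarrow> 1) at_top"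
  proof (rule tendsto_sandwich)
    show "\<forall>\<^sub>F x in at_top. (1 - 1 / x :: real) \<le> real (nat \<lfloor>x\<rfloor>) / x"
      using eventually_gt_at_top[of 0]
    proof eventually_elim
      case (elim x)
      have "x - 1 \<le> real (nat \<lfloor>x\<rfloor>)" by linarith
      then have "(x - 1) / x \<le> real (nat \<lfloor>x\<rfloor>) / x"
        using elim by (intro divide_right_mono) auto
      with elim show ?case by (simp add: diff_divide_distrib)
    qed
    show "\<forall>\<^sub>F x in at_top. real (nat \<lfloor>x\<rfloor>) / x \<le> 1"
      using eventually_gt_at_top[of 0] by eventually_elim (simp add: field_simps)
    show "((\<lambda>x::real. 1 - 1 / x) \<longlongrightarrow> 1) at_top"
      using tendsto_diff[OF tendsto_const, OF tendsto_inverse_0_at_top[OF filterlim_ident], of "1::real"]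
      by (simp add: inverse_eq_divide)
  qed simp
  then show ?thesis by (simp add: has_asymptotic_density_counting counting_UNIV)
qed

lemma has_asymptotic_density_Diff:
  assumes "has_asymptotic_density S d" "has_asymptotic_density R e" "R \<subseteq> S"
  shows "has_asymptotic_density (S - R) (d - e)"
  using tendsto_diff[OF assms(1,2)[unfolded has_asymptotic_density_counting]]
  by (simp add: has_asymptotic_density_counting counting_Diff[OF assms(3)] diff_divide_distrib)

lemma has_asymptotic_density_scale:
  assumes "has_asymptotic_density S d" "a > 0"
  shows "has_asymptotic_density ((*) a ` S) (d / real a)"
proof -
  have "filterlim (\<lambda>x. x / real a) at_top at_top"
    using filterlim_at_top_mult_tendsto_pos[OF tendsto_const _ filterlim_ident, of "1 / real a"] assms(2)
    by simp
  then have "((\<lambda>x. real (counting S (x / real a)) / (x / real a)) \<longlongrightarrow> d) at_top"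
    using assms(1) unfolding has_asymptotic_density_counting by (rule filterlim_compose[rotated])
  from tendsto_divide[OF this tendsto_const, of "real a"] assms(2) show ?thesis
    by (simp add: has_asymptotic_density_counting counting_scale)
qed

lemma has_asymptotic_density_mono:
  assumes "has_asymptotic_density S d" "has_asymptotic_density T e" "S \<subseteq> T"
  shows "d \<le> e"
proof (rule tendsto_le)
  show "((\<lambda>x. real (counting T x) / x) \<longlongrightarrow> e) at_top" "((\<lambda>x. real (counting S x) / x) \<longlongrightarrow> d) at_top"
    using assms by (simp_all add: has_asymptotic_density_counting)
  show "\<forall>\<^sub>F x in at_top. real (counting S x) / x \<le> real (counting T x) / x"
    using eventually_gt_at_top[of 0]
    by eventually_elim (simp add: divide_right_mono counting_mono[OF assms(3)])
qed simp

lemma has_asymptotic_density_empty: "has_asymptotic_density {} 0"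
  by (simp add: has_asymptotic_density_counting counting_def)

section \<open>Sieving by a finite set, then by a set with convergent reciprocal sum\<close>

definition nonmultiples :: "nat set \<Rightarrow> nat set" where
  "nonmultiples A = {n. \<forall>a\<in>A. \<not> a dvd n}"

text \<open>What \<open>b\<close> newly removes are the multiples \<open>b * m\<close> that avoid
  \<open>A\<close>. Since \<open>a div gcd a b\<close> and \<open>b div gcd a b\<close> are coprime,
  \<open>a\<close> divides \<open>b * m\<close> iff \<open>a div gcd a b\<close> divides
  \<open>m\<close>. The inclusion lets the densities be subtracted.\<close>

lemma nonmultiples_insert:
  assumes "b > 0"
  shows "nonmultiples (insert b A)
    = nonmultiples A - (*) b ` nonmultiples ((\<lambda>a. a div gcd a b) ` A)"
    and "(*) b ` nonmultiples ((\<lambda>a. a div gcd a b) ` A) \<subseteq> nonmultiples A"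
proof -
  have *: "a dvd b * m \<longleftrightarrow> a div gcd a b dvd m" for a m
  proof -
    have g: "gcd a b > 0" using assms by simp
    have "a dvd b * m \<longleftrightarrow> gcd a b * (a div gcd a b) dvd gcd a b * (b div gcd a b * m)"
      by (simp flip: mult.assoc)
    also have "\<dots> \<longleftrightarrow> a div gcd a b dvd b div gcd a b * m"
      using g by (simp only: nat_mult_dvd_cancel_disj) linarith
    also have "\<dots> \<longleftrightarrow> a div gcd a b dvd m"
      using div_gcd_coprime[of a b] assms by (simp add: coprime_dvd_mult_right_iff)
    finally show ?thesis .
  qed
  show "nonmultiples (insert b A)
    = nonmultiples A - (*) b ` nonmultiples ((\<lambda>a. a div gcd a b) ` A)"
  proof (rule Set.set_eqI)
    fix n
    show "n \<in> nonmultiples (insert b A) \<longleftrightarrow>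
      n \<in> nonmultiples A - (*) b ` nonmultiples ((\<lambda>a. a div gcd a b) ` A)"
    proof (cases "b dvd n")
      case True
      then obtain m where "n = b * m" ..
      then show ?thesis using assms by (auto simp: nonmultiples_def *)
    next
      case False
      then show ?thesis by (auto simp: nonmultiples_def)
    qed
  qed
  show "(*) b ` nonmultiples ((\<lambda>a. a div gcd a b) ` A) \<subseteq> nonmultiples A"
    by (auto simp: nonmultiples_def *)
qed

text \<open>
  Multiples \<open>b m\<close> of the new element \<open>b\<close> that avoid \<open>A\<close> are scaled nonmultiples of
  \<open>{a / gcd(a, b)}\<close>, a set that is no larger than \<open>A\<close>; as \<open>m\<close> then avoids \<open>A\<close> as well, their
  density is at most \<open>1 / b\<close> times that of the nonmultiples of \<open>A\<close>.
\<close>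

lemma density_nonmultiples_finite:
  assumes "finite A" "0 \<notin> A"
  shows "\<exists>d. has_asymptotic_density (nonmultiples A) d \<and> (\<Prod>a\<in>A. 1 - 1 / real a) \<le> d"
  using assms
\<comment> \<open>Induction on the cardinality, since the hypothesis is needed both for
  \<open>B\<close> and for its image \<open>B'\<close>, which need not be a subset of
  \<open>A\<close>.\<close>
proof (induction "card A" arbitrary: A rule: less_induct)
  case less
  show ?case
  proof (cases "A = {}")
    case True
    then show ?thesis
      using has_asymptotic_density_UNIV by (auto simp: nonmultiples_def)
  next
    case False
    then obtain b B where A: "A = insert b B" and b: "b \<notin> B"
      by (meson Set.set_insert all_not_in_conv)
    have fin: "finite B" and B0: "0 \<notin> B" and b0: "b > 0"
      using less.prems A by auto
    define B' where "B' = (\<lambda>a. a div gcd a b) ` B"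
    have card: "card B < card A" "card B' < card A"
      using A b fin card_image_le[OF fin, of "\<lambda>a. a div gcd a b"] by (auto simp: B'_def)
    have B'0: "0 \<notin> B'"
      using B0 by (auto simp: B'_def dvd_div_eq_0_iff)
    obtain d where d: "has_asymptotic_density (nonmultiples B) d" "(\<Prod>a\<in>B. 1 - 1 / real a) \<le> d"
      using less.hyps[OF card(1) fin B0] by blast
    obtain e where e: "has_asymptotic_density (nonmultiples B') e"
      using less.hyps[OF card(2) _ B'0] fin by (auto simp: B'_def)
    have "a div gcd a b dvd a" for a
      by (metis dvd_triv_right dvd_div_mult_self gcd_dvd1 mult.commute)
    then have "nonmultiples B' \<subseteq> nonmultiples B"
      by (auto simp: nonmultiples_def B'_def dest: dvd_trans)
    then have "e \<le> d"
      by (rule has_asymptotic_density_mono[OF e d(1)])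
    then have "e / real b \<le> d / real b"
      by (intro divide_right_mono) auto
    moreover have "(1 - 1 / real b) * (\<Prod>a\<in>B. 1 - 1 / real a) \<le> (1 - 1 / real b) * d"
      using d(2) b0 by (intro mult_left_mono) auto
    ultimately have "(\<Prod>a\<in>A. 1 - 1 / real a) \<le> d - e / real b"
      using b fin by (simp add: A left_diff_distrib)
    moreover have "has_asymptotic_density (nonmultiples A) (d - e / real b)"
      unfolding A nonmultiples_insert(1)[OF b0]
      using has_asymptotic_density_Diff[OF d(1) has_asymptotic_density_scale[OF e b0]]
        nonmultiples_insert(2)[OF b0] by (simp add: B'_def)
    ultimately show ?thesis by blast
  qed
qed

lemma counting_multiples_le:
  assumes "a > 0" "x \<ge> 0"
  shows "real (counting {n. a dvd n} x) \<le> x / real a"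
proof -
  have "{n. a dvd n} = (*) a ` UNIV" by (auto elim: dvdE)
  then have "real (counting {n. a dvd n} x) = real (nat \<lfloor>x / real a\<rfloor>)"
    by (simp only: counting_scale[OF assms(1)] counting_UNIV)
  also have "\<dots> \<le> x / real a" using assms by simp
  finally show ?thesis .
qed

text \<open>A number up to \<open>x\<close> that avoids the elements of \<open>A\<close> below
  \<open>j\<close> but not all of \<open>A\<close> is a multiple of some \<open>a\<close> in
  \<open>A\<close> with \<open>j\<close> \<le> \<open>a\<close> \<le> \<open>x\<close>; the union
  bound counts these.\<close>

lemma counting_nonmultiples_truncate:
  assumes "0 \<notin> A" "x \<ge> 0"
  shows "real (counting (nonmultiples (A \<inter> {..<j})) x)
    \<le> real (counting (nonmultiples A) x) + x * (\<Sum>a\<in>A \<inter> {j..nat \<lfloor>x\<rfloor>}. 1 / real a)"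
proof -
  let ?S = "\<lambda>S. {n \<in> S. 1 \<le> n \<and> real n \<le> x}"
  have sub: "?S (nonmultiples (A \<inter> {..<j}))
      \<subseteq> ?S (nonmultiples A) \<union> (\<Union>a\<in>A \<inter> {j..nat \<lfloor>x\<rfloor>}. ?S {n. a dvd n})"
  proof
    fix n assume n: "n \<in> ?S (nonmultiples (A \<inter> {..<j}))"
    show "n \<in> ?S (nonmultiples A) \<union> (\<Union>a\<in>A \<inter> {j..nat \<lfloor>x\<rfloor>}. ?S {n. a dvd n})"
    proof (cases "n \<in> nonmultiples A")
      case False
      then obtain a where a: "a \<in> A" "a dvd n" by (auto simp: nonmultiples_def)
      with n have "j \<le> a" by (force simp: nonmultiples_def)
      moreover have "real a \<le> x" using dvd_imp_le[OF a(2)] n by auto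
      then have "a \<le> nat \<lfloor>x\<rfloor>" by (rule le_nat_floor)
      ultimately show ?thesis using n a by auto
    qed (use n in auto)
  qed
  have "counting (nonmultiples (A \<inter> {..<j})) x
      \<le> card (?S (nonmultiples A) \<union> (\<Union>a\<in>A \<inter> {j..nat \<lfloor>x\<rfloor>}. ?S {n. a dvd n}))"
    unfolding counting_def 
    by (intro card_mono[OF _ sub] finite_UnI finite_UN_I finite_counted) auto
  also have "\<dots> \<le> counting (nonmultiples A) x + (\<Sum>a\<in>A \<inter> {j..nat \<lfloor>x\<rfloor>}. counting {n. a dvd n} x)"
    unfolding counting_def by (intro order.trans[OF card_Un_le] add_left_mono card_UN_le) auto
  finally have "real (counting (nonmultiples (A \<inter> {..<j})) x)
      \<le> real (counting (nonmultiples A) x) + (\<Sum>a\<in>A \<inter> {j..nat \<lfloor>x\<rfloor>}. real (counting {n. a dvd n} x))"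
    unfolding of_nat_sum[symmetric] of_nat_add[symmetric] by (rule of_nat_mono)
  also have "(\<Sum>a\<in>A \<inter> {j..nat \<lfloor>x\<rfloor>}. real (counting {n. a dvd n} x)) \<le> (\<Sum>a\<in>A \<inter> {j..nat \<lfloor>x\<rfloor>}. x / real a)"
    using assms by (intro sum_mono counting_multiples_le) (auto intro: gr0I)
  finally show ?thesis by (simp add: sum_distrib_left)
qed

text \<open>The sets sieved by \<open>A\<close> below \<open>j\<close> have densities
  \<open>d j\<close> that decrease to a limit. The tail of the reciprocal sum bounds the error of
  truncation uniformly in \<open>x\<close>, so this limit is the density.\<close>

lemma density_nonmultiples:
  assumes "0 \<notin> A" and sm: "(\<lambda>a. 1 / real a) summable_on A"
  shows "\<exists>d. has_asymptotic_density (nonmultiples A) d \<and> (1 \<notin> A \<longrightarrow> d > 0)"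
proof -
  define r where "r F = (\<Sum>a\<in>F. 1 / real a)" for F :: "nat set"
  have tail: "\<exists>N. \<forall>F. finite F \<and> F \<subseteq> A \<inter> {N..} \<longrightarrow> r F < \<epsilon>" if "\<epsilon> > 0" for \<epsilon>
  proof -
    let ?s = "infsum (\<lambda>a. 1 / real a) A"
    obtain G where G: "finite G" "G \<subseteq> A" "?s - \<epsilon> < r G"
    proof -
      have "\<forall>\<^sub>F F in finite_subsets_at_top A. ?s - \<epsilon> < r F"
        unfolding r_def by (rule order_tendstoD(1)[OF infsum_tendsto[OF sm]]) (use \<open>\<epsilon> > 0\<close> in simp)
      then show ?thesis
        using that unfolding eventually_finite_subsets_at_top by blast
    qed
    \<comment> \<open>\<open>N\<close> lies beyond a finite \<open>G\<close> that already captures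
      the sum up to \<epsilon>; inserting \<open>0\<close> keeps \<open>Max\<close> meaningful when
      \<open>G\<close> is empty.\<close>
    have "r F < \<epsilon>" if F: "finite F" "F \<subseteq> A \<inter> {Suc (Max (insert 0 G))..}" for F
    proof -
      have "G \<inter> F = {}"
      proof -
        have "x < Suc (Max (insert 0 G))" if "x \<in> G" for x
          using that G(1) by (simp add: less_Suc_eq_le)
        then show ?thesis using F(2) by force
      qed
      then have "r G + r F = r (G \<union> F)"
        using F G by (simp add: r_def sum.union_disjoint)
      also have "\<dots> \<le> ?s"
        unfolding r_def by (rule finite_sum_le_infsum[OF sm]) (use F G in auto)
      finally show ?thesis using G(3) by simp
    qed
    then show ?thesis by blast
  qed
  have "\<forall>j. \<exists>d. has_asymptotic_density (nonmultiples (A \<inter> {..<j})) d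
      \<and> (\<Prod>a\<in>A \<inter> {..<j}. 1 - 1 / real a) \<le> d"
    using density_nonmultiples_finite assms(1) by auto
  then obtain d where d: "\<And>j. has_asymptotic_density (nonmultiples (A \<inter> {..<j})) (d j)"
    and dge: "\<And>j. (\<Prod>a\<in>A \<inter> {..<j}. 1 - 1 / real a) \<le> d j"
    by metis
  have "decseq d"
    by (rule decseq_SucI, rule has_asymptotic_density_mono[OF d d]) (auto simp: nonmultiples_def)
  moreover have "d j \<ge> 0" for j
    by (rule has_asymptotic_density_mono[OF has_asymptotic_density_empty d]) simp
  ultimately obtain D where D: "d \<longlonglongrightarrow> D"
    using decseq_convergent[of d 0] by blast
  have "((\<lambda>x. real (counting (nonmultiples A) x) / x) \<longlongrightarrow> D) at_top"
  proof (rule tendstoI)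
    fix \<epsilon> :: real assume "\<epsilon> > 0"
    \<comment> \<open>One third each for the distance from \<open>d j\<close> to \<open>D\<close>,
      the convergence of the truncated quotient, and the tail of the sum.\<close>
    then have e: "\<epsilon> / 3 > 0" by simp
    obtain N where N: "\<And>F. finite F \<Longrightarrow> F \<subseteq> A \<inter> {N..} \<Longrightarrow> r F < \<epsilon> / 3"
      using tail[OF e] by blast
    have "\<forall>\<^sub>F j in sequentially. dist (d j) D < \<epsilon> / 3 \<and> j \<ge> N"
      using tendstoD[OF D e] eventually_ge_at_top[of N] by eventually_elim simp
    then obtain j where j: "dist (d j) D < \<epsilon> / 3" "j \<ge> N"
      using eventually_happens by force
    have "\<forall>\<^sub>F x in at_top. dist (real (counting (nonmultiples (A \<inter> {..<j})) x) / x) (d j) < \<epsilon> / 3"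
      using tendstoD[OF d[of j, unfolded has_asymptotic_density_counting] e] .
    then show "\<forall>\<^sub>F x in at_top. dist (real (counting (nonmultiples A) x) / x) D < \<epsilon>"
      using eventually_gt_at_top[of 0]
    proof eventually_elim
      case (elim x)
      let ?c = "real (counting (nonmultiples A) x)"
      let ?cj = "real (counting (nonmultiples (A \<inter> {..<j})) x)"
      have "?cj \<le> ?c + x * r (A \<inter> {j..nat \<lfloor>x\<rfloor>})"
        unfolding r_def using counting_nonmultiples_truncate[OF assms(1)] elim(2) by simp
      moreover have "r (A \<inter> {j..nat \<lfloor>x\<rfloor>}) < \<epsilon> / 3"
        using j(2) by (intro N) auto
      then have "x * r (A \<inter> {j..nat \<lfloor>x\<rfloor>}) \<le> x * (\<epsilon> / 3)"
        using elim(2) by (intro mult_left_mono) auto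
      ultimately have "?cj \<le> ?c + x * (\<epsilon> / 3)"
        by linarith
      then have "?cj / x \<le> (?c + x * (\<epsilon> / 3)) / x"
        using elim(2) by (intro divide_right_mono) auto
      then have "?cj / x \<le> ?c / x + \<epsilon> / 3"
        using elim(2) by (simp add: add_divide_distrib)
      moreover have "?c / x \<le> ?cj / x"
        using elim(2) by (intro divide_right_mono of_nat_mono counting_mono) (auto simp: nonmultiples_def)
      ultimately show ?case using elim(1) j(1) unfolding dist_real_def by linarith
    qed
  qed
  moreover have "D > 0" if "1 \<notin> A"
  proof -
    have lt: "0 \<le> 1 / real a \<and> 1 / real a < 1" if "a \<in> A" for a
    proof -
      have "a \<noteq> 0" "a \<noteq> 1" using that assms(1) \<open>1 \<notin> A\<close> by metis+
      then show ?thesis by auto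
    qed
    \<comment> \<open>With a tail sum below 1/2, the Weierstrass inequality keeps the tail product
      above 1/2. The finite head \<open>c\<close> is positive as all its factors are, so
      \<open>c * (1 / 2)\<close> bounds every late \<open>d j\<close> from below.\<close>
    obtain N where N: "\<And>F. finite F \<Longrightarrow> F \<subseteq> A \<inter> {N..} \<Longrightarrow> r F < 1 / 2"
      using tail[of "1 / 2"] by auto
    define c where "c = (\<Prod>a\<in>A \<inter> {..<N}. 1 - 1 / real a)"
    have c: "c > 0" unfolding c_def using lt by (intro prod_pos) (auto simp: less_diff_eq)
    have "c * (1 / 2) \<le> d j" if "j \<ge> N" for j
    proof -
      have split: "A \<inter> {..<j} = (A \<inter> {..<N}) \<union> (A \<inter> {N..<j})"
        using that by auto
      have "(\<Prod>a\<in>A \<inter> {..<j}. 1 - 1 / real a) = c * (\<Prod>a\<in>A \<inter> {N..<j}. 1 - 1 / real a)"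
        unfolding c_def split by (rule prod.union_disjoint) auto
      moreover have "1 - r (A \<inter> {N..<j}) \<le> (\<Prod>a\<in>A \<inter> {N..<j}. 1 - 1 / real a)"
        unfolding r_def using lt by (intro Weierstrass_prod_ineq) (auto simp: less_imp_le)
      moreover have "r (A \<inter> {N..<j}) < 1 / 2" by (rule N) auto
      ultimately have "c * (1 / 2) \<le> (\<Prod>a\<in>A \<inter> {..<j}. 1 - 1 / real a)"
        using c by (auto intro!: mult_left_mono)
      with dge[of j] show ?thesis by simp
    qed
    then have "c * (1 / 2) \<le> D"
      by (intro LIMSEQ_le_const[OF D]) blast
    with c show ?thesis by linarith
  qed
  ultimately show ?thesis unfolding has_asymptotic_density_counting by blast
qed

section \<open>Divisibility by the rank of appearance\<close>

text \<open>The recurrence runs backwards modulo \<open>m\<close>, so agreement of consecutive pairs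
  descends to index 0, where \<open>fib 0 = 0\<close>.\<close>

lemma cong_fib_shift_back:
  assumes "[fib (i + d) = fib i] (mod m)" "[fib (Suc (i + d)) = fib (Suc i)] (mod m)"
  shows "m dvd fib d"
  using assms
proof (induction i)
  case 0
  then show ?case by (simp add: cong_0_iff)
next
  case (Suc i)
  have "[fib (Suc (i + d)) + fib (i + d) = fib (Suc i) + fib i] (mod m)"
    using Suc.prems(2) by simp
  moreover have *: "[fib (Suc (i + d)) = fib (Suc i)] (mod m)"
    using Suc.prems(1) by simp
  ultimately have "[fib (Suc i) + fib (i + d) = fib (Suc i) + fib i] (mod m)"
    by (meson cong_add cong_refl cong_sym cong_trans)
  then have "[fib (i + d) = fib i] (mod m)"
    by (simp only: cong_add_lcancel_nat)
  from Suc.IH[OF this *] show ?case .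
qed

text \<open>Pigeonhole: pairs of consecutive residues modulo \<open>m\<close> take finitely many
  values, so two of them coincide.\<close>

lemma dvd_fib_exists:
  assumes "m > 0"
  shows "\<exists>n>0. m dvd fib n"
proof -
  define g where "g i = (fib i mod m, fib (Suc i) mod m)" for i
  have "range g \<subseteq> {..<m} \<times> {..<m}"
    using assms by (auto simp: g_def)
  then have "finite (range g)"
    by (rule finite_subset) simp
  then have "\<not> inj g"
    using finite_imageD infinite_UNIV_nat by blast
  then obtain i j where "g i = g j" "i < j"
    unfolding inj_on_def by (metis nat_neq_iff)
  then have "m dvd fib (j - i)"
    by (intro cong_fib_shift_back[of i]) (auto simp: g_def cong_def)
  with \<open>i < j\<close> show ?thesis by (intro exI[of _ "j - i"]) auto
qed

lemma rank_of_appearance: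
  assumes "m > 0"
  shows "rank_of_appearance m > 0" "m dvd fib (rank_of_appearance m)"
  using LeastI_ex[OF dvd_fib_exists[OF assms]] by (simp_all add: rank_of_appearance_def)

text \<open>Both directions rest on \<open>fib_gcd\<close>: if \<open>m\<close> divides
  \<open>fib n\<close>, it divides \<open>fib\<close> at the gcd of \<open>n\<close> and the rank,
  and minimality makes this gcd the rank itself.\<close>

lemma dvd_fib_iff:
  assumes "m > 0"
  shows "m dvd fib n \<longleftrightarrow> rank_of_appearance m dvd n"
proof
  let ?z = "rank_of_appearance m"
  assume "m dvd fib n"
  then have "m dvd fib (gcd ?z n)"
    using rank_of_appearance(2)[OF assms] by (simp add: fib_gcd)
  moreover have "gcd ?z n > 0"
    using rank_of_appearance(1)[OF assms] by simp
  ultimately have "?z \<le> gcd ?z n"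
    unfolding rank_of_appearance_def by (intro Least_le) simp
  then have "gcd ?z n = ?z"
    by (intro antisym gcd_le1_nat) (use rank_of_appearance(1)[OF assms] in auto)
  then show "?z dvd n"
    by (metis gcd_dvd2)
next
  assume "rank_of_appearance m dvd n"
  then have "gcd (rank_of_appearance m) n = rank_of_appearance m"
    by (simp add: gcd_proj1_iff)
  then have "fib (rank_of_appearance m) = gcd (fib (rank_of_appearance m)) (fib n)"
    using fib_gcd[of "rank_of_appearance m" n] by simp
  then have "fib (rank_of_appearance m) dvd fib n"
    by (metis gcd_dvd2)
  then show "m dvd fib n"
    using rank_of_appearance(2)[OF assms] by (rule dvd_trans[rotated])
qed

lemma dvd_gcd_fib_iff:
  assumes "m > 0"
  shows "m dvd gcd n (fib n) \<longleftrightarrow> ell m dvd n"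
  using dvd_fib_iff[OF assms] by (simp add: ell_def)

lemma ell_pos: "m > 0 \<Longrightarrow> ell m > 0"
  using rank_of_appearance(1) by (simp add: ell_def lcm_pos_nat)

text \<open>Read through \<open>dvd_gcd_fib_iff\<close> at \<open>n = ell b\<close>, this is
  transitivity of divisibility.\<close>

lemma ell_dvd_ell:
  assumes "a dvd b" "b > 0"
  shows "ell a dvd ell b"
proof -
  have "a > 0" using assms by (auto intro: gr0I)
  have "b dvd gcd (ell b) (fib (ell b))"
    unfolding dvd_gcd_fib_iff[OF assms(2)] by (rule dvd_refl)
  with assms(1) have "a dvd gcd (ell b) (fib (ell b))"
    by (rule dvd_trans)
  then show ?thesis
    unfolding dvd_gcd_fib_iff[OF \<open>a > 0\<close>] .
qed

text \<open>A positive \<open>g\<close> equals \<open>k\<close> iff \<open>k\<close> divides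
  \<open>g\<close> and no \<open>k * p\<close> does, because a cofactor other than 1 has a prime
  factor. \<open>dvd_gcd_fib_iff\<close> then turns each condition into one on
  \<open>n\<close>.\<close>

lemma mem_gcd_fib_set_iff:
  assumes "k > 0" "n > 0"
  shows "n \<in> gcd_fib_set k \<longleftrightarrow> ell k dvd n \<and> (\<forall>p. prime p \<longrightarrow> \<not> ell (k * p) dvd n)"
proof -
  define g where "g = gcd n (fib n)"
  have "g > 0" using assms by (simp add: g_def)
  have "g = k \<longleftrightarrow> k dvd g \<and> (\<forall>p. prime p \<longrightarrow> \<not> k * p dvd g)"
  proof (intro iffI conjI allI impI notI)
    fix p :: nat
    assume "g = k" "prime p" and "k * p dvd g"
    with \<open>g > 0\<close> have "p dvd 1" by simp
    with \<open>prime p\<close> show False by simp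
  next
    assume *: "k dvd g \<and> (\<forall>p. prime p \<longrightarrow> \<not> k * p dvd g)"
    then obtain c where c: "g = k * c" by blast
    have "c = 1"
    proof (rule ccontr)
      assume "c \<noteq> 1"
      then obtain p where "prime p" "p dvd c" using prime_factor_nat by blast
      with * c show False by simp
    qed
    with c show "g = k" by simp
  qed simp
  moreover have "k dvd g \<longleftrightarrow> ell k dvd n"
    unfolding g_def by (rule dvd_gcd_fib_iff[OF assms(1)])
  moreover have "k * p dvd g \<longleftrightarrow> ell (k * p) dvd n" if "prime p" for p
    unfolding g_def by (rule dvd_gcd_fib_iff) (use assms(1) prime_gt_0_nat[OF that] in simp)
  moreover have "n \<in> gcd_fib_set k \<longleftrightarrow> g = k"
    using assms(2) by (simp add: gcd_fib_set_def g_def Suc_le_eq)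
  ultimately show ?thesis by blast
qed

section \<open>Primes and their rank of appearance\<close>

text \<open>Binet's formula at an odd index, expanded binomially: even powers of
  \<open>sqrt 5\<close> cancel and odd ones double. Cleared of denominators, it can be reduced
  modulo a prime.\<close>

lemma fib_odd_binomial:
  "4 ^ q * fib (2 * q + 1) = (\<Sum>j\<le>q. ((2 * q + 1) choose (2 * j + 1)) * 5 ^ j)"
proof -
  let ?n = "2 * q + 1"
  have expand: "(1 + x) ^ ?n = (\<Sum>i\<le>?n. real (?n choose i) * x ^ i)" for x :: real
    using binomial_ring[of x 1 ?n] by (simp add: add.commute)
  have "2 ^ ?n * real (fib ?n) * sqrt 5 = (1 + sqrt 5) ^ ?n - (1 + - sqrt 5) ^ ?n"
    by (simp only: fib_closed_form power_divide) (simp add: field_simps)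
  also have "\<dots> = (\<Sum>i\<le>?n. real (?n choose i) * (sqrt 5 ^ i - (- sqrt 5) ^ i))"
    by (simp only: expand sum_subtractf right_diff_distrib)
  also have "\<dots> = (\<Sum>i\<in>{i. i \<le> ?n \<and> odd i}. real (?n choose i) * (sqrt 5 ^ i - (- sqrt 5) ^ i))"
    by (intro sum.mono_neutral_right) auto
  also have "\<dots> = (\<Sum>j\<le>q. real (?n choose (2 * j + 1)) * (2 * (5 ^ j * sqrt 5)))"
  proof (rule sum.reindex_bij_witness[of _ "\<lambda>j. 2 * j + 1" "\<lambda>i. i div 2"])
    fix i assume "i \<in> {i. i \<le> ?n \<and> odd i}"
    then show "real (?n choose (2 * (i div 2) + 1)) * (2 * (5 ^ (i div 2) * sqrt 5)) =
        real (?n choose i) * (sqrt 5 ^ i - (- sqrt 5) ^ i)"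
      by (auto elim!: oddE simp: power_mult)
  qed auto
  also have "\<dots> = 2 * (\<Sum>j\<le>q. real (?n choose (2 * j + 1)) * 5 ^ j) * sqrt 5"
    by (simp add: sum_distrib_left sum_distrib_right mult_ac)
  finally have "2 ^ ?n * real (fib ?n) = 2 * (\<Sum>j\<le>q. real (?n choose (2 * j + 1)) * 5 ^ j)"
    by simp
  then have "real (4 ^ q * fib ?n) = real (\<Sum>j\<le>q. (?n choose (2 * j + 1)) * 5 ^ j)"
    by (simp add: power_mult)
  then show ?thesis by (simp only: of_nat_eq_iff)
qed

text \<open>With \<open>p = 2 * q + 1\<close>, all binomials but the last vanish modulo
  \<open>p\<close>, and \<open>4 ^ q\<close> is 1 by Fermat, so \<open>fib p\<close> is congruent to
  \<open>5 ^ q\<close>. Squaring gives \<open>5 ^ (p - 1)\<close> and avoids the quadratic character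
  of 5.\<close>

lemma fib_prime_square_cong_1:
  assumes "prime p" "p \<noteq> 2" "p \<noteq> 5"
  shows "[fib p ^ 2 = 1] (mod p)"
proof -
  have "odd p" using assms prime_odd_nat prime_ge_2_nat by (metis le_neq_implies_less)
  then obtain q where q: "p = 2 * q + 1" by (rule oddE)
  have fermat: "[a ^ (2 * q) = 1] (mod p)" if "prime a" "p \<noteq> a" for a
    using fermat_theorem[OF assms(1), of a] primes_dvd_imp_eq[OF assms(1) that(1)] that(2) q by auto
  have "[4 ^ q * fib p = (\<Sum>j\<le>q. if j = q then 5 ^ q else 0)] (mod p)"
    unfolding q fib_odd_binomial
  proof (rule cong_sum)
    fix j assume "j \<in> {..q}"
    show "[((2 * q + 1) choose (2 * j + 1)) * 5 ^ j = (if j = q then 5 ^ q else 0)] (mod 2 * q + 1)"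
    proof (cases "j = q")
      case False
      with \<open>j \<in> {..q}\<close> have "p dvd (p choose (2 * j + 1))"
        using assms(1) q by (intro dvd_choose_prime) auto
      with False show ?thesis using q by (simp add: cong_0_iff)
    qed simp
  qed
  then have "[4 ^ q * fib p = 5 ^ q] (mod p)"
    by simp
  moreover have "[4 ^ q * fib p = 1 * fib p] (mod p)"
    using fermat[of 2] assms(2) by (intro cong_mult) (simp_all add: power_mult)
  ultimately have "[fib p = 5 ^ q] (mod p)"
    by (metis cong_sym cong_trans mult_1)
  then have "[fib p ^ 2 = (5 ^ q) ^ 2] (mod p)"
    by (rule cong_pow)
  also have "(5 ^ q) ^ 2 = (5::nat) ^ (2 * q)"
    by (simp add: power_mult power2_eq_square flip: power_mult_distrib)
  also have "[5 ^ (2 * q) = 1] (mod p)"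
    using assms(3) by (intro fermat) auto
  finally show ?thesis .
qed

text \<open>By Cassini's identity \<open>p\<close> divides \<open>fib (p + 1) * fib (p - 1)\<close>,
  so the rank divides \<open>p + 1\<close> or \<open>p - 1\<close>, both coprime to
  \<open>p\<close>.\<close>

lemma coprime_prime_rank_of_appearance:
  assumes "prime p" "p \<noteq> 2" "p \<noteq> 5"
  shows "coprime p (rank_of_appearance p)"
proof -
  have p: "odd p" "p > 2"
    using assms(1,2) prime_odd_nat prime_ge_2_nat by (metis le_neq_implies_less)+
  define n where "n = p - 1"
  have n: "Suc n = p" "even n" using p by (auto simp: n_def)
  have "[fib p ^ 2 - 1 = 0] (mod p)"
    using cong_to_1_nat[OF fib_prime_square_cong_1[OF assms]] by (simp add: cong_0_iff)
  then have "p dvd fib (Suc p) * fib n"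
    using fib_Cassini_nat[of n] n by (simp add: cong_0_iff)
  then have "rank_of_appearance p dvd Suc p \<or> rank_of_appearance p dvd n"
    using assms(1) dvd_fib_iff[of p] p by (auto simp: prime_dvd_mult_iff)
  moreover have "coprime p (Suc p)" "coprime p n"
    using n(1) coprime_Suc_right_nat coprime_Suc_left_nat by blast+
  ultimately show ?thesis
    by (meson coprime_divisors dvd_refl)
qed

section \<open>Primes of a given rank, and convergence of the sum of
  \<open>1 / ell p\<close>\<close>

lemma fib_le_power2: "fib n \<le> 2 ^ n"
  by (induction n rule: fib.induct) auto

lemma card_primes_with_rank_le:
  assumes "m > 0" "F \<subseteq> {p. prime p \<and> rank_of_appearance p = m}"
  shows "card F \<le> m"
proof -
  let ?P = "prime_factors (fib m)"
  have pos: "fib m > 0" by (rule fib_neq_0_nat[OF assms(1)])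
  have "F \<subseteq> ?P"
  proof
    fix p assume "p \<in> F"
    then have "prime p" "rank_of_appearance p = m" using assms(2) by auto
    then have "p dvd fib m"
      using dvd_fib_iff[of p m] by (simp add: prime_gt_0_nat)
    with \<open>prime p\<close> pos show "p \<in> ?P" by (simp add: prime_factors_dvd)
  qed
  then have "card F \<le> card ?P" by (intro card_mono) auto
  have "(2::nat) ^ card ?P = (\<Prod>p\<in>?P. 2)" by simp
  also have "\<dots> \<le> (\<Prod>p\<in>?P. p ^ multiplicity p (fib m))"
  proof (rule prod_mono)
    fix p assume p: "p \<in> ?P"
    then have "multiplicity p (fib m) > 0" "p \<ge> 2"
      by (auto simp: prime_factors_multiplicity prime_ge_2_nat)
    then have "p ^ 1 \<le> p ^ multiplicity p (fib m)"
      by (intro power_increasing) auto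
    with \<open>p \<ge> 2\<close> show "0 \<le> (2::nat) \<and> 2 \<le> p ^ multiplicity p (fib m)" by simp
  qed
  also have "\<dots> = fib m"
    using prime_factorization_nat[OF pos] by simp
  also have "\<dots> \<le> 2 ^ m" by (rule fib_le_power2)
  finally have "card ?P \<le> m" by simp
  with \<open>card F \<le> card ?P\<close> show ?thesis by simp
qed

lemma summable_on_nat_powr:
  assumes "s < -1"
  shows "(\<lambda>n::nat. real n powr s) summable_on A"
proof (rule summable_on_subset_banach)
  show "(\<lambda>n::nat. real n powr s) summable_on UNIV"
    using assms by (subst summable_on_UNIV_nonneg_real_iff) (auto simp: summable_real_powr_iff)
qed simp

text \<open>Grouped by rank, the at most \<open>m\<close> primes of rank \<open>m\<close> contribute
  at most \<open>m * m powr (-5/2) = m powr (-3/2)\<close>, which is summable.\<close>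

lemma summable_on_rank_powr:
  "(\<lambda>p. real (rank_of_appearance p) powr (-5/2)) summable_on {p. prime p}"
proof (rule nonneg_bdd_above_summable_on)
  let ?z = rank_of_appearance
  let ?S = "\<lambda>F. \<Sum>p\<in>F. real (?z p) powr (-5/2)"
  have sm: "(\<lambda>m::nat. real m powr (-3/2)) summable_on UNIV"
    by (rule summable_on_nat_powr) simp
  have "?S F \<le> (\<Sum>\<^sub>\<infinity>m::nat. real m powr (-3/2))" if F: "finite F" "F \<subseteq> {p. prime p}" for F
  proof -
    have "?S F = (\<Sum>m\<in>?z ` F. \<Sum>p\<in>{p \<in> F. ?z p = m}. real (?z p) powr (-5/2))"
      by (rule sum.image_gen[OF F(1)])
    also have "\<dots> \<le> (\<Sum>m\<in>?z ` F. real m powr (-3/2))"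
    proof (rule sum_mono)
      fix m assume "m \<in> ?z ` F"
      then have m: "m > 0"
        using F(2) rank_of_appearance(1) prime_gt_0_nat by auto
      have "(\<Sum>p\<in>{p \<in> F. ?z p = m}. real (?z p) powr (-5/2))
          = real (card {p \<in> F. ?z p = m}) * real m powr (-5/2)"
        by simp
      also have "\<dots> \<le> real m powr 1 * real m powr (-5/2)"
        using m F(2) card_primes_with_rank_le[OF m, of "{p \<in> F. ?z p = m}"]
        by (intro mult_right_mono) auto
      also have "\<dots> = real m powr (-3/2)"
        unfolding powr_add[symmetric] by simp
      finally show "(\<Sum>p\<in>{p \<in> F. ?z p = m}. real (?z p) powr (-5/2)) \<le> real m powr (-3/2)" .
    qed
    also have "\<dots> \<le> (\<Sum>\<^sub>\<infinity>m::nat. real m powr (-3/2))"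
      by (rule finite_sum_le_infsum[OF sm]) (use F in auto)
    finally show ?thesis .
  qed
  then show "bdd_above (?S ` {F. F \<subseteq> {p. prime p} \<and> finite F})"
    by (intro bdd_aboveI2) auto
qed simp

text \<open>Either \<open>y\<close> \<ge> \<open>x powr (2/3)\<close>, and \<open>x * y\<close> is
  at least \<open>x powr (5/3)\<close>, or \<open>x\<close> exceeds \<open>y powr (3/2)\<close>, and
  \<open>x * y\<close> is at least \<open>y powr (5/2)\<close>.\<close>

lemma inverse_mult_le_powr_add:
  fixes x y :: real
  assumes "x > 0" "y > 0"
  shows "1 / (x * y) \<le> x powr (-5/3) + y powr (-5/2)"
proof (cases "x powr (2/3) \<le> y")
  case True
  have "x * x powr (2/3) = x powr (5/3)"
    using assms powr_add[of x 1 "2/3"] by simp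
  moreover have "x * x powr (2/3) \<le> x * y"
    using assms True by (intro mult_left_mono) auto
  ultimately have "1 / (x * y) \<le> 1 / x powr (5/3)"
    using assms by (intro divide_left_mono) auto
  then show ?thesis
    by (simp add: powr_minus_divide add_increasing2)
next
  case False
  then have "y powr (3/2) \<le> (x powr (2/3)) powr (3/2)"
    using assms by (intro powr_mono2) auto
  then have "y powr (3/2) * y \<le> x * y"
    using assms by (intro mult_right_mono) (auto simp: powr_powr)
  moreover have "y powr (3/2) * y = y powr (5/2)"
    using assms powr_add[of y "3/2" 1] by simp
  ultimately have "1 / (x * y) \<le> 1 / y powr (5/2)"
    using assms by (intro divide_left_mono) auto
  then show ?thesis
    by (simp add: powr_minus_divide add_increasing)
qed

lemma summable_on_inverse_ell_prime:
  "(\<lambda>p. 1 / real (ell p)) summable_on {p. prime p}"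
proof -
  let ?P = "{p::nat. prime p}" and ?z = rank_of_appearance
  \<comment> \<open>The formula \<open>ell p = p * ?z p\<close> comes from a coprimality that is
    proved away from 2 and 5; these two terms are added back afterwards.\<close>
  have "(\<lambda>p. 1 / real (ell p)) summable_on (?P - {2, 5})"
  proof (rule summable_on_comparison_test)
    show "(\<lambda>p. real p powr (-5/3) + real (?z p) powr (-5/2)) summable_on (?P - {2, 5})"
      by (intro summable_on_add summable_on_nat_powr summable_on_subset_banach[OF summable_on_rank_powr])
        auto
    fix p assume p: "p \<in> ?P - {2, 5}"
    then have "p > 0" by (simp add: prime_gt_0_nat)
    moreover have "ell p = p * ?z p"
      using p coprime_prime_rank_of_appearance[of p] by (simp add: ell_def lcm_coprime)
    ultimately show "1 / real (ell p) \<le> real p powr (-5/3) + real (?z p) powr (-5/2)"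
      using inverse_mult_le_powr_add[of p "?z p"] rank_of_appearance(1)[of p] by simp
  qed simp
  moreover have "(\<lambda>p. 1 / real (ell p)) summable_on {2, 5}"
    by (rule summable_on_finite) simp
  ultimately have "(\<lambda>p. 1 / real (ell p)) summable_on ((?P - {2, 5}) \<union> {2, 5})"
    by (intro summable_on_Un_disjoint) auto
  then show ?thesis
    by (rule summable_on_subset_banach) auto
qed

section \<open>Density of the set of prescribed gcd\<close>

text \<open>Since \<open>ell k\<close> divides \<open>ell (k * p)\<close>, the factor
  \<open>ell k\<close> cancels from the conditions of \<open>mem_gcd_fib_set_iff\<close> once
  \<open>n = ell k * m\<close>.\<close>

lemma gcd_fib_set_eq_scaled_nonmultiples:
  assumes "k > 0"
  shows "gcd_fib_set k = (*) (ell k) ` nonmultiples ((\<lambda>p. ell (k * p) div ell k) ` {p. prime p})"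
    (is "_ = _ ` nonmultiples ?A")
proof (rule Set.set_eqI)
  fix n
  note L = ell_pos[OF assms]
  have iff: "ell (k * p) dvd ell k * m \<longleftrightarrow> ell (k * p) div ell k dvd m" if "prime p" for p m
  proof -
    have "ell k dvd ell (k * p)"
      using assms that by (intro ell_dvd_ell) (auto simp: prime_gt_0_nat)
    then obtain c where "ell (k * p) = ell k * c" ..
    with L show ?thesis by simp
  qed
  show "n \<in> gcd_fib_set k \<longleftrightarrow> n \<in> (*) (ell k) ` nonmultiples ?A"
  proof (cases "n > 0 \<and> ell k dvd n")
    case True
    then obtain m where m: "n = ell k * m" by blast
    have "n \<in> gcd_fib_set k \<longleftrightarrow> m \<in> nonmultiples ?A"
      using mem_gcd_fib_set_iff[OF assms, of n] True by (auto simp: m iff nonmultiples_def)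
    then show ?thesis using L by (auto simp: m)
  next
    case False
    \<comment> \<open>Everything divides 0, and the prime 2 shows that \<open>?A\<close> is
      nonempty; this matches the positivity demanded in \<open>gcd_fib_set\<close>.\<close>
    have "0 \<notin> nonmultiples ?A"
      using two_is_prime_nat by (auto simp: nonmultiples_def)
    then have "n \<notin> (*) (ell k) ` nonmultiples ?A"
      using False L by (auto intro: gr0I)
    moreover have "n \<notin> gcd_fib_set k"
      using False mem_gcd_fib_set_iff[OF assms, of n] by (auto simp: gcd_fib_set_def)
    ultimately show ?thesis by blast
  qed
qed

lemma summable_on_inverse_ell_quotients:
  assumes "k > 0"
  shows "(\<lambda>a. 1 / real a) summable_on ((\<lambda>p. ell (k * p) div ell k) ` {p. prime p})"
proof -
  let ?g = "\<lambda>p. ell (k * p) div ell k"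
  \<comment> \<open>Different primes may give the same quotient, so the image is reindexed by a set
    \<open>U\<close> of representatives.\<close>
  obtain U where U: "U \<subseteq> {p. prime p}" "inj_on ?g U" "?g ` {p. prime p} = ?g ` U"
    using subset_image_inj[of "?g ` {p. prime p}" ?g "{p. prime p}"] by auto
  have "(\<lambda>p. 1 / real (?g p)) summable_on U"
  proof (rule summable_on_comparison_test)
    show "(\<lambda>p. real (ell k) * (1 / real (ell p))) summable_on U"
      by (intro summable_on_cmult_right summable_on_subset_banach[OF summable_on_inverse_ell_prime U(1)])
    fix p assume "p \<in> U"
    then have p: "p > 0" "k * p > 0"
      using U(1) assms by (auto simp: prime_gt_0_nat)
    have "ell p \<le> ell (k * p)"
      using p by (intro dvd_imp_le ell_dvd_ell ell_pos) auto
    moreover have "ell k dvd ell (k * p)"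
      using p by (intro ell_dvd_ell) auto
    moreover have "ell k > 0" "ell p > 0"
      using p assms by (auto intro: ell_pos)
    ultimately show "1 / real (?g p) \<le> real (ell k) * (1 / real (ell p))"
      by (simp add: real_of_nat_div divide_left_mono)
  qed simp
  then show ?thesis
    unfolding U(3) by (subst summable_on_reindex[OF U(2)]) (simp add: o_def)
qed

theorem theorem1p3:
  fixes k :: nat
  assumes "k \<ge> 1"
  shows "(\<exists>d. has_asymptotic_density (gcd_fib_set k) d) \<and>
    (asymptotic_density (gcd_fib_set k) > 0 \<longleftrightarrow> gcd_fib_set k \<noteq> {}) \<and>
    (gcd_fib_set k \<noteq> {} \<longleftrightarrow> k = gcd (ell k) (fib (ell k)))"
proof -
  have k: "k > 0" using assms by simp
  note L = ell_pos[OF k]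
  define A where "A = (\<lambda>p. ell (k * p) div ell k) ` {p. prime p}"
  have "0 \<notin> A"
  proof
    assume "0 \<in> A"
    then obtain p where p: "prime p" "ell (k * p) div ell k = 0" by (auto simp: A_def)
    moreover have "k * p > 0" using k p(1) by (simp add: prime_gt_0_nat)
    ultimately have "ell (k * p) < ell k" "ell k dvd ell (k * p)" "ell (k * p) > 0"
      using L by (auto simp: div_eq_0_iff intro: ell_dvd_ell ell_pos)
    then show False using dvd_imp_le leD by blast
  qed
  moreover have "(\<lambda>a. 1 / real a) summable_on A"
    unfolding A_def by (rule summable_on_inverse_ell_quotients[OF k])
  ultimately obtain d where d: "has_asymptotic_density (nonmultiples A) d"
    and dpos: "1 \<notin> A \<Longrightarrow> d > 0"
    using density_nonmultiples by blast
  have eq: "gcd_fib_set k = (*) (ell k) ` nonmultiples A"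
    unfolding A_def by (rule gcd_fib_set_eq_scaled_nonmultiples[OF k])
  have dens: "has_asymptotic_density (gcd_fib_set k) (d / real (ell k))"
    unfolding eq by (rule has_asymptotic_density_scale[OF d L])
  have "asymptotic_density (gcd_fib_set k) > 0 \<longleftrightarrow> gcd_fib_set k \<noteq> {}"
  proof
    assume "asymptotic_density (gcd_fib_set k) > 0"
    then show "gcd_fib_set k \<noteq> {}"
      using asymptotic_density_eqI[OF has_asymptotic_density_empty] by auto
  next
    assume "gcd_fib_set k \<noteq> {}"
    \<comment> \<open>If \<open>1\<close> were in \<open>A\<close>, there would be no nonmultiples
      at all.\<close>
    then have "1 \<notin> A" by (auto simp: eq nonmultiples_def)
    then show "asymptotic_density (gcd_fib_set k) > 0"
      using dpos L by (simp add: asymptotic_density_eqI[OF dens])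
  qed
  moreover have "gcd_fib_set k \<noteq> {} \<longleftrightarrow> k = gcd (ell k) (fib (ell k))"
  proof
    assume "gcd_fib_set k \<noteq> {}"
    then obtain n where n: "n \<in> gcd_fib_set k" by blast
    then have "n > 0" by (simp add: gcd_fib_set_def)
    have dvd: "ell k dvd n" and no: "\<And>p. prime p \<Longrightarrow> \<not> ell (k * p) dvd n"
      using n mem_gcd_fib_set_iff[OF k \<open>n > 0\<close>] by blast+
    \<comment> \<open>Any member is a multiple of \<open>ell k\<close>, so a prime excluding
      \<open>ell k\<close> would exclude that member too; hence \<open>ell k\<close> is itself a
      member.\<close>
    have "\<not> ell (k * p) dvd ell k" if "prime p" for p
      using no[OF that] dvd_trans[OF _ dvd] by blast
    then have "ell k \<in> gcd_fib_set k"
      by (simp add: mem_gcd_fib_set_iff[OF k L])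
    then show "k = gcd (ell k) (fib (ell k))" by (simp add: gcd_fib_set_def)
  next
    assume "k = gcd (ell k) (fib (ell k))"
    then have "ell k \<in> gcd_fib_set k" using L by (simp add: gcd_fib_set_def)
    then show "gcd_fib_set k \<noteq> {}" by blast
  qed
  ultimately show ?thesis using dens by blast
qed

end
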